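(* Let $d\ge2$ and let $\mathcal{P}=\{p_1,\ldots,p_d\}\subseteq\mathbb{R}^d$ be any affinely independent set of $d$ points. Let $M_{\mathcal{P}}=\operatorname{Aff}(\mathcal{P})$ be its affine span (an affine hyperplane) and let $$\mathsf{H}_{\mathcal{P}}(x)=\big(|x-p_1|^2,\ldots,|x-p_d|^2\big),\qquad x\in\mathbb{R}^d.$$ Then $$\Sigma_{\mathcal{P}}:=\big\{x\in\mathbb{R}^d:\operatorname{rank}D_x\mathsf{H}_{\mathcal{P}}(x)\leq d-1\big\}=M_{\mathcal{P}}.$$ Moreover, $$\operatorname{rank}\big(D_x\mathsf{H}_{\mathcal{P}}(x)|_{T_xM_{\mathcal{P}}}\big)=d-1,\qquad x\in M_{\mathcal{P}}.$$ Consequently, the family $\{|x-p_1|^2,\ldots,|x-p_d|^2\}$ satisfies the critical-hypersurface and tangential-immersion conditions. Moreover, $\mathsf{H}_{\mathcal{P}}$ is fold non-degenerate on $\mathbb{R}^d$.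
   Context: $|\cdot|$ is the Euclidean norm. For a family of $d$ scalar $C^2$ functions on $\mathbb{R}^d$ with encoding map $\mathsf{H}=(\varphi_1,\ldots,\varphi_d)$ and critical set $\Sigma=\{x:\operatorname{rank}D_x\mathsf{H}(x)\le d-1\}$: the critical-hypersurface condition is that there is a $C^1$ embedded $(d-1)$-dimensional submanifold $M\subset\mathbb{R}^d$ with $\Sigma\subseteq M$; the tangential-immersion condition relative to such $M$ is that $\operatorname{rank}(D_x\mathsf{H}(x)|_{T_xM})=d-1$ for every $x\in M$. With $J=\det D_x\mathsf{H}$, the map $\mathsf{H}$ is fold non-degenerate on an open set $U$ if every $x\in U\cap\Sigma$ satisfies $\operatorname{rank}D_x\mathsf{H}(x)=d-1$ and $D_xJ(x)[v]\neq0$ for all $v\in\ker D_x\mathsf{H}(x)\setminus\{0\}$. *)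

theory Defs
  imports "HOL-Analysis.Analysis"
begin

text \<open>The Frechet derivative is taken in the space of bounded linear maps, so that continuity of
  the derivative refers to the operator norm and the definition can be iterated.\<close>

definition C1_on :: "('a::real_normed_vector \<Rightarrow> 'b::real_normed_vector) \<Rightarrow> 'a set \<Rightarrow> bool" where
  "C1_on f U \<longleftrightarrow> (\<exists>f' :: 'a \<Rightarrow> 'a \<Rightarrow>\<^sub>L 'b.
     (\<forall>x\<in>U. (f has_derivative blinfun_apply (f' x)) (at x)) \<and> continuous_on U f')"

definition C2_on :: "('a::real_normed_vector \<Rightarrow> 'b::real_normed_vector) \<Rightarrow> 'a set \<Rightarrow> bool" where
  "C2_on f U \<longleftrightarrow> (\<exists>f' :: 'a \<Rightarrow> 'a \<Rightarrow>\<^sub>L 'b.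
     (\<forall>x\<in>U. (f has_derivative blinfun_apply (f' x)) (at x)) \<and> C1_on f' U)"

definition C1_diffeo :: "'a::real_normed_vector set \<Rightarrow> 'a set \<Rightarrow> ('a \<Rightarrow> 'a) \<Rightarrow> ('a \<Rightarrow> 'a) \<Rightarrow> bool" where
  "C1_diffeo U V \<Phi> \<Psi> \<longleftrightarrow> homeomorphism U V \<Phi> \<Psi> \<and> C1_on \<Phi> U \<and> C1_on \<Psi> V"

text \<open>Embedded submanifolds via slice charts: locally, a diffeomorphism of the ambient space
  straightens \<open>M\<close> to a linear subspace of dimension \<open>k\<close>.\<close>

definition C1_submanifold :: "nat \<Rightarrow> 'a::euclidean_space set \<Rightarrow> bool" where
  "C1_submanifold k M \<longleftrightarrow> (\<forall>x\<in>M. \<exists>U V \<Phi> \<Psi> S. open U \<and> open V \<and> x \<in> U \<and> C1_diffeo U V \<Phi> \<Psi> \<and>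
     subspace S \<and> dim S = k \<and> \<Phi> ` (U \<inter> M) = V \<inter> S)"

text \<open>Velocities at \<open>x\<close> of \<open>C\<^sup>1\<close> curves lying in \<open>M\<close>.\<close>

definition tangent_space :: "'a::euclidean_space set \<Rightarrow> 'a \<Rightarrow> 'a set" where
  "tangent_space M x = {v. \<exists>\<gamma> :: real \<Rightarrow> 'a. \<exists>\<epsilon>>0. \<gamma> C1_differentiable_on {-\<epsilon><..<\<epsilon>} \<and>
     \<gamma> ` {-\<epsilon><..<\<epsilon>} \<subseteq> M \<and> \<gamma> 0 = x \<and> (\<gamma> has_vector_derivative v) (at 0)}"

text \<open>The finite type \<open>'n\<close> indexes both the coordinates of the space and the members of the family,
  so \<open>d = CARD('n)\<close>. The notions below are meant for families of \<open>C\<^sup>2\<close> functions: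
  \<^const>\<open>jacobian\<close> and \<^const>\<open>frechet_derivative\<close> carry no information at points of
  non-differentiability.\<close>

definition encoding_map :: "('n::finite \<Rightarrow> real^'n \<Rightarrow> real) \<Rightarrow> real^'n \<Rightarrow> real^'n" where
  "encoding_map \<phi> x = (\<chi> i. \<phi> i x)"

abbreviation D_enc :: "('n::finite \<Rightarrow> real^'n \<Rightarrow> real) \<Rightarrow> real^'n \<Rightarrow> real^'n^'n" where
  "D_enc \<phi> x \<equiv> jacobian (encoding_map \<phi>) (at x)"

definition critical_set :: "('n::finite \<Rightarrow> real^'n \<Rightarrow> real) \<Rightarrow> (real^'n) set" where
  "critical_set \<phi> = {x. rank (D_enc \<phi> x) \<le> CARD('n) - 1}"

definition critical_hypersurface_via ::
  "('n::finite \<Rightarrow> real^'n \<Rightarrow> real) \<Rightarrow> (real^'n) set \<Rightarrow> bool" where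
  "critical_hypersurface_via \<phi> M \<longleftrightarrow> C1_submanifold (CARD('n) - 1) M \<and> critical_set \<phi> \<subseteq> M"

definition critical_hypersurface :: "('n::finite \<Rightarrow> real^'n \<Rightarrow> real) \<Rightarrow> bool" where
  "critical_hypersurface \<phi> \<longleftrightarrow> (\<exists>M. critical_hypersurface_via \<phi> M)"

text \<open>The rank of the restriction of a linear map to a subspace is the dimension of the image.\<close>

definition restricted_rank :: "real^'n^'m \<Rightarrow> (real^'n) set \<Rightarrow> nat" where
  "restricted_rank A T = dim ((\<lambda>v. A *v v) ` T)"

definition tangential_immersion ::
  "('n::finite \<Rightarrow> real^'n \<Rightarrow> real) \<Rightarrow> (real^'n) set \<Rightarrow> bool" where
  "tangential_immersion \<phi> M \<longleftrightarrow>
     (\<forall>x\<in>M. restricted_rank (D_enc \<phi> x) (tangent_space M x) = CARD('n) - 1)"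

definition jac_det :: "('n::finite \<Rightarrow> real^'n \<Rightarrow> real) \<Rightarrow> real^'n \<Rightarrow> real" where
  "jac_det \<phi> x = det (D_enc \<phi> x)"

definition fold_nondegenerate ::
  "('n::finite \<Rightarrow> real^'n \<Rightarrow> real) \<Rightarrow> (real^'n) set \<Rightarrow> bool" where
  "fold_nondegenerate \<phi> U \<longleftrightarrow> open U \<and> (\<forall>x \<in> U \<inter> critical_set \<phi>.
     rank (D_enc \<phi> x) = CARD('n) - 1 \<and>
     (\<forall>v. D_enc \<phi> x *v v = 0 \<and> v \<noteq> 0 \<longrightarrow> frechet_derivative (jac_det \<phi>) (at x) v \<noteq> 0))"

definition sq_dist_family :: "('n::finite \<Rightarrow> real^'n) \<Rightarrow> 'n \<Rightarrow> real^'n \<Rightarrow> real" where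
  "sq_dist_family p i x = (norm (x - p i))\<^sup>2"

end

theory Submission
  imports Defs
begin

text \<open>The derivative at \<open>x\<close> has rows \<open>2 (x - p\<^sub>i)\<close>. A vector in its kernel is orthogonal to all
  differences \<open>p\<^sub>i - p\<^sub>k\<close>, hence a multiple of the normal \<open>a\<close> of the affine hull; and \<open>a\<close> itself
  lies in the kernel exactly when \<open>x\<close> lies on the hull. The Jacobian determinant is an affine function
  of \<open>x\<close> whose linear part vanishes only on directions tangent to the hull, never on \<open>a\<close>.\<close>

text \<open>The derivative is constantly \<open>f\<close>. This covers both the gradient of a
  squared distance, needed for \<open>C2_on\<close>, and the translations used as slice
  charts.\<close>

lemma C1_on_bounded_linear_diff_const:
  assumes "bounded_linear f"
  shows "C1_on (\<lambda>x. f (x - a)) U"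
  unfolding C1_on_def
proof (intro exI conjI ballI)
  show "((\<lambda>x. f (x - a)) has_derivative blinfun_apply (Blinfun f)) (at x)" for x
    unfolding bounded_linear_Blinfun_apply[OF assms]
    by (rule bounded_linear.has_derivative[OF assms]) (auto intro!: derivative_eq_intros)
qed simp

lemma C2_on_sq_dist_family: "C2_on (sq_dist_family p i) U"
  unfolding C2_on_def
proof (intro exI conjI ballI)
  let ?f' = "\<lambda>x. blinfun_inner_right (2 *\<^sub>R (x - p i))"
  show "(sq_dist_family p i has_derivative blinfun_apply (?f' x)) (at x)" for x
    unfolding sq_dist_family_def[abs_def] power2_norm_eq_inner
    by (auto intro!: derivative_eq_intros simp: inner_commute)
  have "bounded_linear (\<lambda>x :: real^'a. blinfun_inner_right (2 *\<^sub>R x))"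
    by (intro bounded_linear_compose[OF bounded_linear_blinfun_inner_right]
        bounded_linear_scaleR_right)
  from C1_on_bounded_linear_diff_const[OF this] show "C1_on ?f' U" .
qed

lemma D_enc_sq_dist_family: "D_enc (sq_dist_family p) x = (\<chi> i. 2 *\<^sub>R (x - p i))"
proof -
  let ?A = "(\<chi> i. 2 *\<^sub>R (x - p i)) :: real^'a^'a"
  have "((\<lambda>x. (x - p i) \<bullet> (x - p i)) has_derivative (\<lambda>v. (?A *v v) $ i)) (at x)" for i
    unfolding matrix_vector_mul_component
    by (auto intro!: derivative_eq_intros simp: inner_commute)
  then have "(encoding_map (sq_dist_family p) has_derivative (\<lambda>v. ?A *v v)) (at x)"
    unfolding has_derivative_componentwise_within[of "encoding_map _"]
    by (auto simp: Basis_vec_def inner_axis encoding_map_def sq_dist_family_def power2_norm_eq_inner)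
  then have "frechet_derivative (encoding_map (sq_dist_family p)) (at x) = (\<lambda>v. ?A *v v)"
    by (rule frechet_derivative_at[symmetric])
  then show ?thesis
    by (simp add: jacobian_def)
qed

lemma D_enc_sq_dist_family_mult:
  "(D_enc (sq_dist_family p) x *v v) $ i = 2 * ((x - p i) \<bullet> v)"
  by (simp add: D_enc_sq_dist_family matrix_vector_mul_component)

text \<open>Along a curve inside the hyperplane \<open>a \<bullet> \<gamma> t\<close> is constant,
  so every velocity is orthogonal to \<open>a\<close>. Conversely, the straight line through
  \<open>x\<close> with velocity \<open>v\<close> orthogonal to \<open>a\<close> never leaves the
  hyperplane.\<close>

lemma tangent_space_hyperplane:
  fixes a x :: "'a::euclidean_space"
  assumes "a \<bullet> x = b"
  shows "tangent_space {y. a \<bullet> y = b} x = {v. a \<bullet> v = 0}"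
proof (intro equalityI subsetI)
  fix v assume "v \<in> tangent_space {y. a \<bullet> y = b} x"
  then obtain \<gamma> \<epsilon> where \<epsilon>: "\<epsilon> > 0" and img: "\<gamma> ` {-\<epsilon><..<\<epsilon>} \<subseteq> {y. a \<bullet> y = b}"
    and der: "(\<gamma> has_vector_derivative v) (at 0)"
    unfolding tangent_space_def by auto
  have "((\<lambda>t. a \<bullet> \<gamma> t) has_vector_derivative a \<bullet> v) (at 0)"
    by (rule bounded_linear.has_vector_derivative[OF bounded_linear_inner_right der])
  moreover have "((\<lambda>t. a \<bullet> \<gamma> t) has_vector_derivative 0) (at 0)"
    by (rule has_vector_derivative_transform_within_open
        [where S = "{-\<epsilon><..<\<epsilon>}" and f = "\<lambda>_. b"]) (use \<epsilon> img in \<open>auto simp: image_subset_iff\<close>)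
  ultimately show "v \<in> {v. a \<bullet> v = 0}"
    using vector_derivative_unique_at by blast
next
  fix v assume v: "v \<in> {v. a \<bullet> v = 0}"
  have "((\<lambda>t. x + t *\<^sub>R v) has_vector_derivative v) (at t)" for t
    by (auto intro!: derivative_eq_intros)
  moreover from this have "(\<lambda>t. x + t *\<^sub>R v) C1_differentiable_on {-1<..<1}"
    unfolding C1_differentiable_on_def by (intro exI[of _ "\<lambda>_. v"]) auto
  moreover have "(\<lambda>t. x + t *\<^sub>R v) ` {-1<..<1} \<subseteq> {y. a \<bullet> y = b}"
    using v assms by (auto simp: inner_add_right)
  ultimately show "v \<in> tangent_space {y. a \<bullet> y = b} x"
    unfolding tangent_space_def by (intro CollectI exI[of _ "\<lambda>t. x + t *\<^sub>R v"] exI[of _ 1]) auto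
qed

lemma C1_submanifold_hyperplane:
  fixes a :: "'a::euclidean_space"
  assumes "a \<noteq> 0"
  shows "C1_submanifold (DIM('a) - 1) {y. a \<bullet> y = b}"
  unfolding C1_submanifold_def
proof
  fix x assume x: "x \<in> {y. a \<bullet> y = b}"
  \<comment> \<open>One translation straightens the whole hyperplane. The inverse is written as a
    difference to fit \<open>C1_on_bounded_linear_diff_const\<close>.\<close>
  let ?\<Phi> = "\<lambda>y. y - x" and ?\<Psi> = "\<lambda>y. y - (- x)"
  have "C1_diffeo UNIV UNIV ?\<Phi> ?\<Psi>"
    unfolding C1_diffeo_def
    by (intro conjI C1_on_bounded_linear_diff_const[OF bounded_linear_ident] homeomorphismI
        continuous_intros) simp_all
  moreover have "?\<Phi> ` (UNIV \<inter> {y. a \<bullet> y = b}) = UNIV \<inter> {v. a \<bullet> v = 0}"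
  proof (intro equalityI subsetI)
    fix v assume "v \<in> UNIV \<inter> {v. a \<bullet> v = 0}"
    then show "v \<in> ?\<Phi> ` (UNIV \<inter> {y. a \<bullet> y = b})"
      using x by (intro image_eqI[of _ _ "v + x"]) (auto simp: inner_add_right)
  qed (use x in \<open>auto simp: inner_diff_right\<close>)
  ultimately show "\<exists>U V \<Phi> \<Psi> S. open U \<and> open V \<and> x \<in> U \<and> C1_diffeo U V \<Phi> \<Psi> \<and>
     subspace S \<and> dim S = DIM('a) - 1 \<and> \<Phi> ` (U \<inter> {y. a \<bullet> y = b}) = V \<inter> S"
    using dim_hyperplane[OF assms] subspace_hyperplane[of a]
    by (intro exI[of _ UNIV] exI[of _ ?\<Phi>] exI[of _ ?\<Psi>] exI[of _ "{v. a \<bullet> v = 0}"]) simp_all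
qed

text \<open>Let \<open>u\<close> be the component of \<open>v\<close> orthogonal to
  \<open>a\<close>. Then \<open>q + u\<close> stays in the hull, on which
  \<open>v \<bullet> y\<close> is constant because it is so on \<open>S\<close>. Hence
  \<open>v \<bullet> u = 0\<close>, and therefore \<open>u \<bullet> u = 0\<close>.\<close>

lemma normal_eq_scaleR:
  fixes a v :: "'a::euclidean_space"
  assumes hull: "affine hull S = {x. a \<bullet> x = b}" and q: "q \<in> S" and "a \<noteq> 0"
    and orth: "\<And>y. y \<in> S \<Longrightarrow> (y - q) \<bullet> v = 0"
  obtains c where "v = c *\<^sub>R a"
proof -
  define u where "u = v - ((a \<bullet> v) / (a \<bullet> a)) *\<^sub>R a"
  have au: "a \<bullet> u = 0"
    using \<open>a \<noteq> 0\<close> by (simp add: u_def inner_diff_right)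
  have "a \<bullet> q = b"
    using hull hull_inc[OF q, of affine] by auto
  then have "q + u \<in> affine hull S"
    using au hull by (simp add: inner_add_right)
  moreover have "affine hull S \<subseteq> {y. v \<bullet> y = v \<bullet> q}"
    using orth by (intro hull_minimal affine_hyperplane) (auto simp: algebra_simps inner_commute)
  ultimately have "v \<bullet> u = 0"
    by (auto simp: inner_add_right)
  then have "u \<bullet> u = 0"
    using au by (subst (1) u_def) (simp add: inner_diff_left)
  then show ?thesis
    using that u_def by auto
qed

lemma linear_det_row:
  fixes c :: "'n::finite \<Rightarrow> real^'n"
  shows "linear (\<lambda>w. det (\<chi> i. if i = k then w else c i))"
proof (rule linearI)
  fix r :: real and w
  show "det (\<chi> i. if i = k then r *\<^sub>R w else c i) = r *\<^sub>R det (\<chi> i. if i = k then w else c i)"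
    using det_row_mul[of k r "\<lambda>_. w" c] by (simp add: scalar_mult_eq_scaleR cong: if_cong)
qed (rule det_row_add)

lemma det_eq_0_iff_ker:
  fixes A :: "real^'n^'n"
  shows "det A = 0 \<longleftrightarrow> (\<exists>v. v \<noteq> 0 \<and> A *v v = 0)"
proof -
  have "det A \<noteq> 0 \<longleftrightarrow> (\<exists>B. B ** A = mat 1)"
    by (simp add: invertible_det_nz[symmetric] invertible_left_inverse)
  then show ?thesis
    unfolding matrix_left_invertible_ker by blast
qed

text \<open>Subtracting row \<open>k\<close> from the other rows leaves a matrix which depends on \<open>x\<close> only through
  row \<open>k\<close>, so the Jacobian determinant is affine in \<open>x\<close>.\<close>

lemma jac_det_sq_dist_family:
  fixes p :: "'n::finite \<Rightarrow> real^'n"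
  obtains C where "C \<noteq> 0"
    "\<And>x. jac_det (sq_dist_family p) x = C * det (\<chi> i. if i = k then x - p k else p k - p i)"
proof -
  \<comment> \<open>\<open>E\<close> undoes the row subtraction and restores the factor 2: row
    \<open>k\<close> is doubled, and row \<open>i\<close> becomes twice the sum of rows
    \<open>i\<close> and \<open>k\<close>, which is \<open>2 (x - p i)\<close>.\<close>
  define E :: "real^'n^'n" where "E = (\<chi> i j. (if j = i then 2 else 0) + (if j = k \<and> i \<noteq> k then 2 else 0))"
  let ?B = "\<lambda>x. \<chi> i. if i = k then x - p k else p k - p i"
  have Em: "(E *v v) $ i = (if i = k then 2 * v $ k else 2 * (v $ i + v $ k))" for v i
  proof -
    have "(E *v v) $ i = (\<Sum>j\<in>UNIV. (if j = i then 2 * v $ j else 0) +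
        (if j = k then if i = k then 0 else 2 * v $ k else 0))"
      unfolding E_def matrix_vector_mult_def vec_lambda_beta by (rule sum.cong) auto
    then show ?thesis
      by (auto simp: sum.distrib)
  qed
  \<comment> \<open>Coordinate \<open>k\<close> vanishes first and then forces the others; this
    replaces a computation of \<open>det E\<close>.\<close>
  have "v = 0" if "E *v v = 0" for v
  proof -
    have *: "(if i = k then 2 * v $ k else 2 * (v $ i + v $ k)) = 0" for i
      using Em[of v i] that by simp
    from *[of k] have "v $ k = 0" by simp
    then have "v $ i = 0" for i
      using *[of i] by (simp split: if_splits)
    then show ?thesis by (simp add: vec_eq_iff)
  qed
  then have "det E \<noteq> 0"
    using det_eq_0_iff_ker by blast
  moreover have "jac_det (sq_dist_family p) x = det E * det (?B x)" for x
  proof -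
    have "(E ** ?B x) $ i $ l = (E *v (\<chi> j. ?B x $ j $ l)) $ i" for i l
      by (simp add: matrix_matrix_mult_def matrix_vector_mult_def)
    then have "D_enc (sq_dist_family p) x = E ** ?B x"
      by (auto simp: vec_eq_iff D_enc_sq_dist_family Em)
    then show ?thesis
      by (simp add: jac_det_def det_mul)
  qed
  ultimately show ?thesis
    by (rule that)
qed

text \<open>The linear part of the Jacobian determinant is, up to a nonzero factor, the determinant
  with \<open>v\<close> in row \<open>k\<close>. If it vanishes, that matrix has a null vector
  \<open>u\<close>, which is orthogonal to all its rows.\<close>

lemma frechet_derivative_jac_det_sq_dist_family_eq_0:
  fixes p :: "'n::finite \<Rightarrow> real^'n"
  assumes "frechet_derivative (jac_det (sq_dist_family p)) (at x) v = 0"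
  obtains u where "u \<noteq> 0" "v \<bullet> u = 0" "\<And>i. (p i - p k) \<bullet> u = 0"
proof -
  let ?L = "\<lambda>w. det (\<chi> i. if i = k then w else p k - p i)"
  obtain C where C: "C \<noteq> 0" "\<And>x. jac_det (sq_dist_family p) x = C * ?L (x - p k)"
    using jac_det_sq_dist_family by blast
  have "bounded_linear ?L"
    by (simp add: linear_det_row linear_conv_bounded_linear[symmetric])
  then have "((\<lambda>x. ?L (x - p k)) has_derivative ?L) (at x)"
    by (rule bounded_linear.has_derivative) (auto intro!: derivative_eq_intros)
  then have "((\<lambda>x. C * ?L (x - p k)) has_derivative (\<lambda>v. C * ?L v)) (at x)"
    by (rule has_derivative_mult_right)
  then have "(jac_det (sq_dist_family p) has_derivative (\<lambda>v. C * ?L v)) (at x)"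
    using C(2) by presburger
  from frechet_derivative_at[OF this, symmetric] have "?L v = 0"
    using assms C(1) by simp
  then obtain u where u: "u \<noteq> 0" "(\<chi> i. if i = k then v else p k - p i) *v u = 0"
    unfolding det_eq_0_iff_ker by blast
  have *: "(if i = k then v else p k - p i) \<bullet> u = 0" for i
    using arg_cong[OF u(2), of "\<lambda>w. w $ i"]
    unfolding matrix_vector_mul_component vec_lambda_beta zero_index .
  have "v \<bullet> u = 0"
    using *[of k] by simp
  moreover have "(p i - p k) \<bullet> u = 0" for i
    using *[of i] by (cases "i = k") (auto simp: inner_diff_left)
  ultimately show ?thesis
    using that u(1) by blast
qed

theorem proposition2p1:
  fixes p :: "'n::finite \<Rightarrow> real^'n"
  assumes "CARD('n) \<ge> 2"
    and "inj p"
    and "\<not> affine_dependent (range p)"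
  shows "aff_dim (affine hull (range p)) = int CARD('n) - 1
    \<and> (\<forall>i. C2_on (sq_dist_family p i) UNIV)
    \<and> critical_set (sq_dist_family p) = affine hull (range p)
    \<and> (\<forall>x \<in> affine hull (range p).
         restricted_rank (D_enc (sq_dist_family p) x) (tangent_space (affine hull (range p)) x)
           = CARD('n) - 1)
    \<and> critical_hypersurface (sq_dist_family p)
    \<and> critical_hypersurface_via (sq_dist_family p) (affine hull (range p))
    \<and> tangential_immersion (sq_dist_family p) (affine hull (range p))
    \<and> fold_nondegenerate (sq_dist_family p) UNIV"
proof -
  let ?M = "affine hull (range p)"
  let ?A = "D_enc (sq_dist_family p)"
  have dim: "aff_dim (range p) = int CARD('n) - 1"
    using aff_dim_affine_independent[OF assms(3)] card_image[OF assms(2)] by simp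
  then obtain a b where a: "a \<noteq> 0" and M: "?M = {x. a \<bullet> x = b}"
    using aff_dim_eq_hyperplane[of "range p"] by auto
  \<comment> \<open>An arbitrary index, whose point serves as base point of the hull.\<close>
  obtain k :: 'n where True by simp
  have pb: "a \<bullet> p i = b" for i
    using M hull_inc[of "p i" "range p" affine] by auto
  have normal: "\<exists>c. v = c *\<^sub>R a" if "\<And>i. (p i - p k) \<bullet> v = 0" for v
    using normal_eq_scaleR[OF M _ a, of "p k" v] that by blast
  have ker: "\<exists>c. v = c *\<^sub>R a" if "?A x *v v = 0" for x v
  proof (rule normal)
    fix i
    \<comment> \<open>Subtracting two of these equations cancels \<open>x\<close>, so the kernel
      lies on the line of \<open>a\<close> at every \<open>x\<close>, critical or not.\<close>
    have "(x - p j) \<bullet> v = 0" for j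
      using D_enc_sq_dist_family_mult[of p x v j] that by simp
    from this[of i] this[of k] show "(p i - p k) \<bullet> v = 0"
      by (simp add: inner_diff_left)
  qed
  have crit_iff: "rank (?A x) \<le> CARD('n) - 1 \<longleftrightarrow> x \<in> ?M" for x
  proof -
    \<comment> \<open>Since \<open>CARD('n)\<close> is positive, the truncated subtraction is
      harmless and the bound means \<open>rank < CARD('n)\<close>.\<close>
    have "rank (?A x) \<le> CARD('n) - 1 \<longleftrightarrow> det (?A x) = 0"
      using assms(1) by (auto simp: det_eq_0_rank)
    also have "\<dots> \<longleftrightarrow> (\<exists>v. v \<noteq> 0 \<and> ?A x *v v = 0)"
      by (rule det_eq_0_iff_ker)
    also have "\<dots> \<longleftrightarrow> ?A x *v a = 0"
      using a ker by (metis matrix_vector_mult_scaleR scaleR_eq_0_iff)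
    \<comment> \<open>As \<open>a \<bullet> p i = b\<close> for all \<open>i\<close>, every
      coordinate of \<open>?A x *v a\<close> equals \<open>2 * (a \<bullet> x - b)\<close>.\<close>
    also have "\<dots> \<longleftrightarrow> a \<bullet> x = b"
      unfolding vec_eq_iff D_enc_sq_dist_family_mult
      by (simp add: inner_commute[of _ a] inner_diff_right pb)
    finally show ?thesis
      by (simp add: M)
  qed
  then have crit: "critical_set (sq_dist_family p) = ?M"
    unfolding critical_set_def by blast
  \<comment> \<open>The kernel lies on the line of \<open>a\<close>, which meets the complement of
    \<open>a\<close> only in 0, so the derivative is injective there for every
    \<open>x\<close>.\<close>
  have image: "dim ((\<lambda>v. ?A x *v v) ` {v. a \<bullet> v = 0}) = CARD('n) - 1" for x
  proof -
    have "inj_on (\<lambda>v. ?A x *v v) (span {v. a \<bullet> v = 0})"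
      unfolding span_eq_iff[THEN iffD2, OF subspace_hyperplane]
    proof (subst linear_inj_on_iff_eq_0[OF matrix_vector_mul_linear subspace_hyperplane], intro ballI impI)
      fix v assume "v \<in> {v. a \<bullet> v = 0}" "?A x *v v = 0"
      with ker[of x v] show "v = 0" by auto
    qed
    then show ?thesis
      using dim_hyperplane[OF a] by (simp add: dim_image_eq[OF matrix_vector_mul_linear])
  qed
  have rr: "restricted_rank (?A x) (tangent_space ?M x) = CARD('n) - 1" if "x \<in> ?M" for x
    using that image by (simp add: M tangent_space_hyperplane restricted_rank_def)
  have via: "critical_hypersurface_via (sq_dist_family p) ?M"
    unfolding critical_hypersurface_via_def crit
    using C1_submanifold_hyperplane[OF a, of b] by (simp add: M)
  have "fold_nondegenerate (sq_dist_family p) UNIV"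
    unfolding fold_nondegenerate_def
  proof (intro conjI ballI allI impI)
    fix x assume x: "x \<in> UNIV \<inter> critical_set (sq_dist_family p)"
    \<comment> \<open>The image of the hyperplane directions already has this dimension; criticality
      of \<open>x\<close> gives the opposite bound.\<close>
    have "CARD('n) - 1 \<le> rank (?A x)"
      unfolding rank_dim_range image[of x, symmetric] by (intro dim_subset image_mono) simp
    with x show "rank (?A x) = CARD('n) - 1"
      unfolding critical_set_def by simp
    fix v assume v: "?A x *v v = 0 \<and> v \<noteq> 0"
    show "frechet_derivative (jac_det (sq_dist_family p)) (at x) v \<noteq> 0"
    proof
      assume "frechet_derivative (jac_det (sq_dist_family p)) (at x) v = 0"
      then obtain u where u: "u \<noteq> 0" "v \<bullet> u = 0" "\<And>i. (p i - p k) \<bullet> u = 0"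
        using frechet_derivative_jac_det_sq_dist_family_eq_0 by blast
      \<comment> \<open>Both \<open>u\<close> and \<open>v\<close> are nonzero multiples of
        \<open>a\<close>, so they cannot be orthogonal.\<close>
      with normal[of u] ker[of x v] v a show False by auto
    qed
  qed simp
  then show ?thesis
    using dim C2_on_sq_dist_family crit rr via
    unfolding critical_hypersurface_def tangential_immersion_def aff_dim_affine_hull by blast
qed

end
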